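(* Let $d,n\ge 1$ be integers and $1\le p<\infty$. Let $K\subset\mathbb{R}^{d\times n}$ be a compact set that is invariant under permutations of columns, and let $f:K\to\mathbb{R}^{d\times n}$ be continuous and permutation equivariant, i.e. $f(\mathbf{Z}\mathbf{P})=f(\mathbf{Z})\mathbf{P}$ for every $\mathbf{Z}\in K$ and every $n\times n$ permutation matrix $\mathbf{P}$. Then for every $\epsilon>0$ there exists a Transformer $g\in\mathcal{T}_2$ with one-layer and single-head self-attention such that $$\mathbf{d}_p(f,g)=\left(\int_K\left\|f(\mathbf{X})-g(\mathbf{X})\right\|_p^p\,\mathrm{d}\mathbf{X}\right)^{1/p}<\epsilon.$$
   Context: $\|\cdot\|_p$ is the entrywise $\ell^p$ norm; $\sigma_S$ is the softmax function, applied column by column to matrices; $\sigma_R$ is the elementwise ReLU; $\mathbf{A}_{:,k}$ is the $k$-th column of $\mathbf{A}$. $\mathcal{T}_2$ is the set of all maps $\mathcal{F}^{(FF)}_2\circ\mathcal{F}^{(SA)}_S\circ\mathcal{F}^{(FF)}_1:\mathbb{R}^{d\times n}\to\mathbb{R}^{d\times n}$, where: - $\mathcal{F}^{(SA)}_S$ is a single-head softmax self-attention layer, $\mathcal{F}^{(SA)}_S(\mathbf{Z})=\mathbf{Z}+\mathbf{W}^{(O)}(\mathbf{W}^{(V)}\mathbf{Z})\,\sigma_S[(\mathbf{W}^{(K)}\mathbf{Z})^\top(\mathbf{W}^{(Q)}\mathbf{Z})]$, with $\mathbf{W}^{(V)},\mathbf{W}^{(K)},\mathbf{W}^{(Q)}\in\mathbb{R}^{s\times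 d}$, $\mathbf{W}^{(O)}\in\mathbb{R}^{d\times s}$ and some head size $s\ge 1$; - $\mathcal{F}^{(FF)}_1,\mathcal{F}^{(FF)}_2$ are feed-forward layers, i.e. maps of the form $\mathcal{F}^{(FF)}(\mathbf{H})_{:,k}=\mathbf{H}_{:,k}+\mathbf{W}^{(2)}\sigma_R[\mathbf{W}^{(1)}\mathbf{H}_{:,k}+\mathbf{b}^{(1)}]+\mathbf{b}^{(2)}$ for $k\in\{1,\dots,n\}$, with $\mathbf{W}^{(1)}\in\mathbb{R}^{q\times d}$, $\mathbf{W}^{(2)}\in\mathbb{R}^{d\times q}$, $\mathbf{b}^{(1)}\in\mathbb{R}^q$, $\mathbf{b}^{(2)}\in\mathbb{R}^d$ and some hidden dimension $q\ge 1$ (which may differ between the two layers). *)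

theory Defs
  imports "HOL-Analysis.Analysis"
begin

text \<open>
  A $d \times n$ matrix is an element of \<^typ>\<open>real^'n^'d\<close> (rows indexed by \<open>'d\<close>, columns by
  \<open>'n\<close>). The hidden dimensions \<open>s\<close> and \<open>q\<close> are existentially quantified, so they cannot be types;
  a matrix with one hidden dimension is a function from natural numbers to vectors, of which only
  the values at indices below the hidden dimension are used:
    \<^item> \<open>W1, WV, WK, WQ :: nat \<Rightarrow> real^'d\<close> list the rows of $q \times d$ or $s \times d$ matrices;
    \<^item> \<open>W2, WO :: nat \<Rightarrow> real^'d\<close> list the columns of $d \times q$ or $d \times s$ matrices.
\<close>

definition softmax :: "real^'n \<Rightarrow> real^'n" where
  "softmax v = (\<chi> i. exp (v $ i) / (\<Sum>j\<in>UNIV. exp (v $ j)))"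

definition softmax_cols :: "real^'n^'m \<Rightarrow> real^'n^'m" where
  "softmax_cols A = (\<chi> i k. softmax (column k A) $ i)"

definition relu :: "real \<Rightarrow> real" where
  "relu x = max 0 x"

text \<open>\<open>WK a v* Z\<close> is row \<open>a\<close> of the product of the key matrix with \<open>Z\<close>.\<close>

definition attention_scores ::
  "nat \<Rightarrow> (nat \<Rightarrow> real^'d) \<Rightarrow> (nat \<Rightarrow> real^'d) \<Rightarrow> real^'n^'d \<Rightarrow> real^'n^'n" where
  "attention_scores s WK WQ Z = (\<chi> i j. \<Sum>a<s. (WK a v* Z) $ i * (WQ a v* Z) $ j)"

definition self_attention ::
  "nat \<Rightarrow> (nat \<Rightarrow> real^'d) \<Rightarrow> (nat \<Rightarrow> real^'d) \<Rightarrow> (nat \<Rightarrow> real^'d) \<Rightarrow> (nat \<Rightarrow> real^'d)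
    \<Rightarrow> real^'n^'d \<Rightarrow> real^'n^'d" where
  "self_attention s WO WV WK WQ Z =
     Z + (\<chi> i k. \<Sum>a<s. WO a $ i * ((WV a v* Z) v* softmax_cols (attention_scores s WK WQ Z)) $ k)"

definition self_attention_layers :: "(real^'n^'d \<Rightarrow> real^'n^'d) set" where
  "self_attention_layers = {self_attention s WO WV WK WQ | s WO WV WK WQ. s \<ge> 1}"

definition ff_token ::
  "nat \<Rightarrow> (nat \<Rightarrow> real^'d) \<Rightarrow> (nat \<Rightarrow> real) \<Rightarrow> (nat \<Rightarrow> real^'d) \<Rightarrow> real^'d \<Rightarrow> real^'d \<Rightarrow> real^'d" where
  "ff_token q W1 b1 W2 b2 h = h + (\<Sum>j<q. relu (W1 j \<bullet> h + b1 j) *\<^sub>R W2 j) + b2"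

definition feed_forward ::
  "nat \<Rightarrow> (nat \<Rightarrow> real^'d) \<Rightarrow> (nat \<Rightarrow> real) \<Rightarrow> (nat \<Rightarrow> real^'d) \<Rightarrow> real^'d
    \<Rightarrow> real^'n^'d \<Rightarrow> real^'n^'d" where
  "feed_forward q W1 b1 W2 b2 H = (\<chi> i k. ff_token q W1 b1 W2 b2 (column k H) $ i)"

definition feed_forward_layers :: "(real^'n^'d \<Rightarrow> real^'n^'d) set" where
  "feed_forward_layers = {feed_forward q W1 b1 W2 b2 | q W1 b1 W2 b2. q \<ge> 1}"

definition transformers2 :: "(real^'n^'d \<Rightarrow> real^'n^'d) set" where
  "transformers2 = {F2 \<circ> A \<circ> F1 | F2 A F1.
     F2 \<in> feed_forward_layers \<and> A \<in> self_attention_layers \<and> F1 \<in> feed_forward_layers}"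

definition permutation_matrix :: "real^'n^'n \<Rightarrow> bool" where
  "permutation_matrix P \<longleftrightarrow> (\<exists>\<pi>. \<pi> permutes UNIV \<and> P = (\<chi> i j. if i = \<pi> j then 1 else 0))"

definition column_permutation_invariant :: "(real^'n^'d) set \<Rightarrow> bool" where
  "column_permutation_invariant K \<longleftrightarrow> (\<forall>Z\<in>K. \<forall>P. permutation_matrix P \<longrightarrow> Z ** P \<in> K)"

definition permutation_equivariant_on ::
  "(real^'n^'d) set \<Rightarrow> (real^'n^'d \<Rightarrow> real^'n^'d) \<Rightarrow> bool" where
  "permutation_equivariant_on K f \<longleftrightarrow>
     (\<forall>Z\<in>K. \<forall>P. permutation_matrix P \<longrightarrow> f (Z ** P) = f Z ** P)"

definition entrywise_norm :: "real \<Rightarrow> real^'n^'d \<Rightarrow> real" where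
  "entrywise_norm p A = (\<Sum>i\<in>UNIV. \<Sum>k\<in>UNIV. \<bar>A $ i $ k\<bar> powr p) powr (1 / p)"

text \<open>
  A Bochner integral is 0 when the integrand is not integrable. The lemma
  \<open>set_integrable_entrywise_norm_powr\<close> below rules this out for maps that are continuous on a
  compact set, and \<open>continuous_on_transformers2\<close> shows that it applies to every transformer.
\<close>

definition lp_dist ::
  "real \<Rightarrow> (real^'n^'d) set \<Rightarrow> (real^'n^'d \<Rightarrow> real^'n^'d) \<Rightarrow> (real^'n^'d \<Rightarrow> real^'n^'d) \<Rightarrow> real" where
  "lp_dist p K f g = (LINT X:K|lborel. entrywise_norm p (f X - g X) powr p) powr (1 / p)"

lemma set_integrable_entrywise_norm_powr:
  fixes f g :: "real^'n^'d \<Rightarrow> real^'n^'d"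
  assumes "compact K" "continuous_on K f" "continuous_on K g" "p \<ge> 1"
  shows "set_integrable lborel K (\<lambda>X. entrywise_norm p (f X - g X) powr p)"
proof -
  have "entrywise_norm p A powr p = (\<Sum>i\<in>UNIV. \<Sum>k\<in>UNIV. \<bar>A $ i $ k\<bar> powr p)" for A :: "real^'n^'d"
    using assms(4) by (simp add: entrywise_norm_def powr_powr sum_nonneg)
  moreover have "continuous_on K (\<lambda>X. \<Sum>i\<in>UNIV. \<Sum>k\<in>UNIV. \<bar>(f X - g X) $ i $ k\<bar> powr p)"
    using assms by (intro continuous_intros continuous_on_powr') auto
  ultimately show ?thesis
    unfolding set_integrable_def using borel_integrable_compact[OF assms(1)] by (simp only:)
qed

lemma continuous_on_matrix_of_entries:
  fixes f :: "'a::topological_space \<Rightarrow> real^'n^'d"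
  assumes "\<And>i k. continuous_on S (\<lambda>x. f x $ i $ k)"
  shows "continuous_on S f"
proof -
  have "continuous_on S (\<lambda>x. \<chi> i. \<chi> k. f x $ i $ k)"
    by (intro continuous_on_vec_lambda assms)
  then show ?thesis by simp
qed

lemma continuous_on_self_attention:
  fixes S :: "(real^'n^'d) set"
  shows "continuous_on S (self_attention s WO WV WK WQ)"
proof (rule continuous_on_matrix_of_entries)
  fix i :: 'd and k :: 'n
  have "(\<Sum>j\<in>UNIV. exp (v j)) \<noteq> 0" for v :: "'n \<Rightarrow> real"
    by (rule less_imp_neq[symmetric]) (auto intro: sum_pos)
  then show "continuous_on S (\<lambda>Z. self_attention s WO WV WK WQ Z $ i $ k)"
    unfolding self_attention_def attention_scores_def softmax_cols_def softmax_def column_def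
      vector_matrix_mult_def
    by (auto intro!: continuous_intros)
qed

lemma continuous_on_feed_forward: "continuous_on S (feed_forward q W1 b1 W2 b2)"
  unfolding feed_forward_def ff_token_def relu_def column_def inner_vec_def
  by (rule continuous_on_matrix_of_entries) (auto intro!: continuous_intros)

lemma continuous_on_transformers2:
  assumes "g \<in> transformers2"
  shows "continuous_on S g"
  using assms unfolding transformers2_def feed_forward_layers_def self_attention_layers_def
  by (auto intro!: continuous_on_compose continuous_on_self_attention continuous_on_feed_forward)

end

theory Submission
  imports Defs "HOL-Library.Nat_Bijection" "HOL-Computational_Algebra.Polynomial"
begin

text \<open>
  The first feed-forward layer turns each token into a positive integer by steep ReLU ramps that
  converge pointwise to threshold tests; the outcomes of the tests are the binary digits. As the
  steepness grows, the layer agrees at every fixed input with the exact quantization from some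
  point on, and the two later layers do not depend on the steepness, so dominated convergence
  reduces the claim to a pointwise estimate for the exact quantization.

  On an axis, attention maps the integers $u_k$ to
  $u_k + \beta\,\sum_j u_j e^{\alpha u_k u_j} / \sum_j e^{\alpha u_k u_j}$. With $x = e^{\alpha u_k}$
  the quotient is $x P'(x) / P(x)$ for $P = \sum_j X^{u_j}$, so for all but finitely many $\alpha$
  and $\beta$ the result determines $u_k$ and the multiset of all $u_j$. The second feed-forward layer
  interpolates a column of $f$ at one chosen input for each of the finitely many results; by
  equivariance and uniform continuity this column is almost right for all inputs with that result.
\<close>

section \<open>One-hidden-layer ReLU networks\<close>

text \<open>Neurons are added one at a time with the width left implicit, so closure properties
  follow by induction. There is no skip connection here; it is cancelled afterwards.\<close>

inductive_set relu_nets :: "(real^'d \<Rightarrow> real^'d) set" where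
  const: "(\<lambda>h. b) \<in> relu_nets"
| add_neuron: "F \<in> relu_nets \<Longrightarrow> (\<lambda>h. F h + relu (w \<bullet> h + b) *\<^sub>R c) \<in> relu_nets"

lemma relu_nets_neuron: "(\<lambda>h. relu (w \<bullet> h + b) *\<^sub>R c) \<in> relu_nets"
  using relu_nets.add_neuron[OF relu_nets.const[of 0]] by simp

lemma relu_nets_add:
  assumes "F \<in> relu_nets" "G \<in> relu_nets"
  shows "(\<lambda>h. F h + G h) \<in> relu_nets"
  using assms(2)
proof induction
  case (const b)
  show ?case using assms(1)
  proof induction
    case (const b')
    show ?case by (rule relu_nets.const)
  next
    case (add_neuron F w b' c)
    from relu_nets.add_neuron[OF add_neuron.IH, of w b' c] show ?case
      by (simp add: algebra_simps)
  qed
next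
  case (add_neuron G w b c)
  from relu_nets.add_neuron[OF add_neuron.IH, of w b c] show ?case
    by (simp add: algebra_simps)
qed

lemma relu_nets_sum:
  assumes "\<And>a. a \<in> A \<Longrightarrow> F a \<in> relu_nets"
  shows "(\<lambda>h. \<Sum>a\<in>A. F a h) \<in> relu_nets"
  using assms
proof (induction A rule: infinite_finite_induct)
  case (insert a A)
  then show ?case by (simp add: relu_nets_add)
qed (simp_all add: relu_nets.const)

lemma uminus_in_relu_nets: "(\<lambda>h :: real^'d. - h) \<in> relu_nets"
proof -
  \<comment> \<open>Each coordinate is the difference of its positive and negative parts, which
    costs two neurons.\<close>
  have "(\<lambda>h :: real^'d. \<Sum>i\<in>UNIV. relu (axis i 1 \<bullet> h + 0) *\<^sub>R (- axis i 1)
      + relu ((- axis i 1) \<bullet> h + 0) *\<^sub>R axis i 1) \<in> relu_nets"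
    by (intro relu_nets_sum relu_nets_add relu_nets_neuron)
  moreover have "(\<Sum>i\<in>UNIV. relu (axis i 1 \<bullet> h + 0) *\<^sub>R (- axis i 1)
      + relu ((- axis i 1) \<bullet> h + 0) *\<^sub>R axis i 1) = - h" for h :: "real^'d"
  proof -
    have "(\<Sum>i\<in>UNIV. relu (axis i 1 \<bullet> h + 0) *\<^sub>R (- axis i 1)
        + relu ((- axis i 1) \<bullet> h + 0) *\<^sub>R axis i 1) = (\<Sum>i\<in>UNIV. - (h $ i *s axis i 1))"
      by (rule sum.cong)
        (auto simp: relu_def inner_axis' max_def scalar_mult_eq_scaleR simp flip: scaleR_minus_left)
    then show ?thesis by (simp add: sum_negf basis_expansion)
  qed
  ultimately show ?thesis by simp
qed

lemma relu_nets_imp_ff_form: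
  assumes "F \<in> relu_nets"
  shows "\<exists>(q::nat) W1 b1 W2 b2. q \<ge> 1 \<and> F = (\<lambda>h. (\<Sum>j<q. relu (W1 j \<bullet> h + b1 j) *\<^sub>R W2 j) + b2)"
  using assms
proof induction
  case (const b)
  \<comment> \<open>A layer has at least one neuron, so a constant is written with one neuron of
    output weight 0.\<close>
  show ?case by (rule exI[of _ "1::nat"], rule exI, rule exI, rule exI[of _ "\<lambda>_. 0"], rule exI[of _ b]) simp
next
  case (add_neuron F w b c)
  from add_neuron.IH obtain q :: nat and W1 b1 W2 b2
    where F: "F = (\<lambda>h. (\<Sum>j<q. relu (W1 j \<bullet> h + b1 j) *\<^sub>R W2 j) + b2)"
    by (elim exE conjE)
  have "(\<lambda>h. F h + relu (w \<bullet> h + b) *\<^sub>R c) = (\<lambda>h. (\<Sum>j<Suc q. relu ((W1(q := w)) j \<bullet> h + (b1(q := b)) j)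
      *\<^sub>R (W2(q := c)) j) + b2)"
    unfolding F by (simp add: ac_simps)
  moreover have "Suc q \<ge> 1" by simp
  ultimately show ?case by (intro exI conjI)
qed

text \<open>The hidden network realizes \<open>F h - h\<close>, and the skip connection adds
  \<open>h\<close> back.\<close>

lemma feed_forward_layers_relu_nets:
  assumes "F \<in> relu_nets"
  shows "(\<lambda>H. \<chi> i k. F (column k H) $ i) \<in> feed_forward_layers"
proof -
  obtain q :: nat and W1 b1 W2 b2 where q: "q \<ge> 1"
    and eq: "(\<lambda>h. F h + - h) = (\<lambda>h. (\<Sum>j<q. relu (W1 j \<bullet> h + b1 j) *\<^sub>R W2 j) + b2)"
    using relu_nets_imp_ff_form[OF relu_nets_add[OF assms uminus_in_relu_nets]] by blast
  have "ff_token q W1 b1 W2 b2 = F"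
  proof
    fix h show "ff_token q W1 b1 W2 b2 h = F h"
      using fun_cong[OF eq, of h] by (simp add: ff_token_def algebra_simps)
  qed
  then have "(\<lambda>H. \<chi> i k. F (column k H) $ i) = feed_forward q W1 b1 W2 b2"
    by (simp add: feed_forward_def fun_eq_iff)
  then show ?thesis using q unfolding feed_forward_layers_def by blast
qed

text \<open>The points are handled in increasing order. A new neuron switches on before
  \<open>b\<close> but not before any earlier point, so its slope corrects the value at
  \<open>b\<close> without disturbing the earlier ones.\<close>

lemma relu_nets_interpolate:
  fixes C :: "real set" and T :: "real \<Rightarrow> real^'d" and i0 :: 'd
  assumes "finite C"
  shows "\<exists>F. (\<lambda>h. F (h $ i0)) \<in> relu_nets \<and> (\<forall>x\<in>C. F x = T x)"
  using assms
proof (induction rule: finite_linorder_max_induct)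
  case empty
  then show ?case using relu_nets.const[of 0] by (intro exI[of _ "\<lambda>_. 0"]) auto
next
  case (insert b A)
  then obtain F where F: "(\<lambda>h. F (h $ i0)) \<in> relu_nets" "\<And>x. x \<in> A \<Longrightarrow> F x = T x" by blast
  obtain b' where b': "b' < b" "\<And>a. a \<in> A \<Longrightarrow> a \<le> b'"
  proof (cases "A = {}")
    case True
    then show ?thesis using that[of "b - 1"] by auto
  next
    case False
    then show ?thesis using that[of "Max A"] insert.hyps by auto
  qed
  define G where "G x = F x + relu (x - b') *\<^sub>R ((T b - F b) /\<^sub>R (b - b'))" for x
  have "(\<lambda>h. F (h $ i0) + relu (axis i0 1 \<bullet> h + - b') *\<^sub>R ((T b - F b) /\<^sub>R (b - b'))) \<in> relu_nets"
    by (rule relu_nets.add_neuron[OF F(1)])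
  then have "(\<lambda>h. G (h $ i0)) \<in> relu_nets"
    by (simp add: G_def inner_axis')
  moreover have "G x = T x" if "x \<in> insert b A" for x
  proof (cases "x = b")
    case True
    then show ?thesis using b'(1) by (simp add: G_def relu_def)
  next
    case False
    then show ?thesis using that b'(2)[of x] F(2) by (simp add: G_def relu_def)
  qed
  ultimately show ?case by blast
qed

section \<open>Attention as a contextual mapping\<close>

text \<open>The derivative in \<open>t\<close> of the log-sum-exp function of
  \<open>t * y j\<close>; \<open>t\<close> acts as an inverse temperature.\<close>

definition softmax_mean :: "('n::finite \<Rightarrow> real) \<Rightarrow> real \<Rightarrow> real" where
  "softmax_mean y t = (\<Sum>j\<in>UNIV. y j * exp (t * y j)) / (\<Sum>j\<in>UNIV. exp (t * y j))"

text \<open>A head of size 1 reads and writes only the coordinate \<open>i0\<close>. The score of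
  key \<open>j\<close> against query \<open>k\<close> is \<open>\<alpha> * y j * y k\<close>, so
  each query sets its own inverse temperature.\<close>

lemma self_attention_on_axis:
  fixes y :: "'n::finite \<Rightarrow> real" and i0 :: "'d::finite"
  shows "self_attention 1 (\<lambda>_. axis i0 \<beta>) (\<lambda>_. axis i0 1) (\<lambda>_. axis i0 \<alpha>) (\<lambda>_. axis i0 1)
      (\<chi> i k. if i = i0 then y k else 0)
    = (\<chi> i k. if i = i0 then y k + \<beta> * softmax_mean y (\<alpha> * y k) else 0)"
proof -
  let ?Z = "\<chi> i k. if i = i0 then y k else 0 :: real^'n^'d"
  have row: "axis i0 b v* ?Z = (\<chi> k. b * y k)" for b
  proof -
    have "axis i0 b $ i * (if i = i0 then y k else 0) = (if i = i0 then b * y k else 0)" for i k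
      by (simp add: axis_def)
    then show ?thesis by (simp add: vec_eq_iff vector_matrix_mult_def mult.commute)
  qed
  have "softmax_cols (attention_scores 1 (\<lambda>_. axis i0 \<alpha>) (\<lambda>_. axis i0 1) ?Z) $ j $ k
      = exp (\<alpha> * y k * y j) / (\<Sum>l\<in>UNIV. exp (\<alpha> * y k * y l))" for j k
    by (simp add: attention_scores_def row softmax_cols_def softmax_def column_def ac_simps)
  then have "((axis i0 1 v* ?Z) v* softmax_cols (attention_scores 1 (\<lambda>_. axis i0 \<alpha>) (\<lambda>_. axis i0 1) ?Z)) $ k
      = softmax_mean y (\<alpha> * y k)" for k
    unfolding row by (simp add: vector_matrix_mult_def softmax_mean_def sum_divide_distrib mult.commute)
  then show ?thesis
    by (simp add: self_attention_def vec_eq_iff) (simp add: axis_def)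
qed

definition count_poly :: "('n::finite \<Rightarrow> nat) \<Rightarrow> real poly" where
  "count_poly u = (\<Sum>k\<in>UNIV. monom 1 (u k))"

lemma coeff_count_poly: "coeff (count_poly u) m = real (card {k. u k = m})"
  by (simp add: count_poly_def coeff_sum sum.If_cases)

text \<open>Equal coefficients mean equal multiplicities of all values, so the two families are
  rearrangements of each other.\<close>

lemma count_poly_eq_imp_permutes:
  assumes "count_poly u = count_poly v"
  obtains \<pi> where "\<pi> permutes UNIV" "u = v \<circ> \<pi>"
proof -
  have "count (image_mset u (mset_set UNIV)) m = count (image_mset v (mset_set UNIV)) m" for m
  proof -
    have "card {k. u k = m} = card {k. v k = m}"
      using arg_cong[OF assms, of "\<lambda>p. coeff p m"] by (simp add: coeff_count_poly)
    then show ?thesis by (simp add: count_image_mset vimage_def)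
  qed
  then have "image_mset u (mset_set UNIV) = image_mset v (mset_set UNIV)"
    by (simp add: multiset_eq_iff)
  then obtain p where "p permutes UNIV" "\<forall>x\<in>UNIV. u x = v (p x)"
    by (rule image_mset_eq_implies_permutes[OF finite])
  then show ?thesis using that by (auto simp: fun_eq_iff)
qed

lemma poly_count_poly_pos: "poly (count_poly u) x > 0" if "x > 0"
  unfolding count_poly_def poly_sum poly_monom using that by (auto intro!: sum_pos)

lemma pderiv_sum: "pderiv (\<Sum>x\<in>A. p x) = (\<Sum>x\<in>A. pderiv (p x))"
  by (induction A rule: infinite_finite_induct) (simp_all add: pderiv_add)

lemma softmax_mean_count_poly:
  fixes u :: "'n::finite \<Rightarrow> nat"
  shows "softmax_mean (\<lambda>k. real (u k)) t
    = exp t * poly (pderiv (count_poly u)) (exp t) / poly (count_poly u) (exp t)"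
proof -
  have "real (u k) * exp (t * real (u k)) = exp t * poly (pderiv (monom 1 (u k))) (exp t)" for k
  proof (cases "u k")
    case (Suc m)
    have "exp (t * real (u k)) = exp t * exp t ^ m"
      using exp_of_nat_mult[of "u k" t] by (simp add: Suc mult.commute)
    then show ?thesis by (simp add: pderiv_monom poly_monom Suc)
  qed (simp add: pderiv_monom)
  moreover have "exp (t * real (u k)) = poly (monom 1 (u k)) (exp t)" for k
    using exp_of_nat_mult[of "u k" t] by (simp add: poly_monom mult.commute)
  ultimately show ?thesis
    by (simp add: softmax_mean_def count_poly_def poly_sum pderiv_sum sum_distrib_left)
qed

text \<open>If the Wronskian vanishes, the quotient of the two polynomials is constant on the positive
  reals, and this constant is 1 because both polynomials take the value \<open>CARD('n)\<close> at 1.\<close>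

lemma count_poly_wronskian_nonzero:
  fixes u v :: "'n::finite \<Rightarrow> nat"
  assumes "count_poly u \<noteq> count_poly v"
  shows "pderiv (count_poly u) * count_poly v - count_poly u * pderiv (count_poly v) \<noteq> 0"
proof
  let ?P = "count_poly u" and ?Q = "count_poly v"
  assume W: "pderiv ?P * ?Q - ?P * pderiv ?Q = 0"
  let ?r = "\<lambda>x. poly ?P x / poly ?Q x"
  have deriv: "(?r has_real_derivative 0) (at x within {0<..})" if "x \<in> {0<..}" for x
  proof -
    have "poly ?Q x \<noteq> 0" using poly_count_poly_pos[of x v] that by auto
    then have "(?r has_real_derivative
        (poly (pderiv ?P) x * poly ?Q x - poly ?P x * poly (pderiv ?Q) x) / (poly ?Q x * poly ?Q x))
        (at x within {0<..})"
      by (intro DERIV_divide has_field_derivative_at_within[OF poly_DERIV])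
    then show ?thesis using arg_cong[OF W, of "\<lambda>p. poly p x"] by simp
  qed
  obtain c where c: "\<And>x. x \<in> {0<..} \<Longrightarrow> ?r x = c"
    using has_field_derivative_zero_constant[OF convex_real_interval(3) deriv] by blast
  have "?r 1 = 1" by (simp add: count_poly_def poly_sum poly_monom)
  with c[of 1] have "c = 1" by simp
  have "poly (?P - ?Q) x = 0" if "x > 0" for x
    using c[of x] \<open>c = 1\<close> poly_count_poly_pos[OF that, of v] that by (simp add: field_simps)
  then have "{0<..} \<subseteq> {x. poly (?P - ?Q) x = 0}" by auto
  moreover have "infinite {0 :: real<..}" by (rule infinite_Ioi)
  ultimately have "?P - ?Q = 0" using poly_roots_finite finite_subset by blast
  with assms show False by simp
qed

text \<open>After clearing denominators, equal means say that \<open>exp (\<alpha> * m)\<close> is a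
  root of the Wronskian. There are finitely many roots, and \<open>m \<noteq> 0\<close> makes the
  exponential injective in \<alpha>, so only finitely many \<alpha> are excluded.\<close>

lemma exists_separating_temperature:
  fixes U :: "('n::finite \<Rightarrow> nat) set" and N :: "nat set"
  assumes "finite U" "finite N" "0 \<notin> N"
  shows "\<exists>\<alpha>::real. \<forall>u\<in>U. \<forall>v\<in>U. \<forall>m\<in>N.
    softmax_mean (\<lambda>k. real (u k)) (\<alpha> * real m) = softmax_mean (\<lambda>k. real (v k)) (\<alpha> * real m)
    \<longrightarrow> count_poly u = count_poly v"
proof -
  define W where "W u v = pderiv (count_poly u) * count_poly v - count_poly u * pderiv (count_poly v)"
    for u v :: "'n \<Rightarrow> nat"
  define bad where "bad = (\<Union>u\<in>U. \<Union>v\<in>{v\<in>U. count_poly u \<noteq> count_poly v}. \<Union>m\<in>N.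
    (\<lambda>\<alpha>. exp (\<alpha> * real m)) -` {x. poly (W u v) x = 0})"
  have "finite bad"
    unfolding bad_def
  proof (intro finite_UN_I finite_vimageI)
    fix u v :: "'n \<Rightarrow> nat" and m assume "v \<in> {v\<in>U. count_poly u \<noteq> count_poly v}" "m \<in> N"
    then show "finite {x. poly (W u v) x = 0}" "inj (\<lambda>\<alpha>. exp (\<alpha> * real m))"
      using assms poly_roots_finite[OF count_poly_wronskian_nonzero[of u v]]
      by (auto simp: W_def inj_on_def intro: gr0I)
  qed (use assms in auto)
  then obtain \<alpha> where \<alpha>: "\<alpha> \<notin> bad"
    using ex_new_if_finite infinite_UNIV_char_0 by blast
  show ?thesis
  proof (intro exI[of _ \<alpha>] ballI impI)
    fix u v :: "'n \<Rightarrow> nat" and m assume uvm: "u \<in> U" "v \<in> U" "m \<in> N"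
      and eq: "softmax_mean (\<lambda>k. real (u k)) (\<alpha> * real m) = softmax_mean (\<lambda>k. real (v k)) (\<alpha> * real m)"
    let ?x = "exp (\<alpha> * real m)"
    have pos: "poly (count_poly u) ?x \<noteq> 0" "poly (count_poly v) ?x \<noteq> 0"
      using poly_count_poly_pos[of ?x u] poly_count_poly_pos[of ?x v] by simp_all
    with eq have "poly (W u v) ?x = 0"
      by (simp add: softmax_mean_count_poly W_def field_simps)
    with \<alpha> uvm show "count_poly u = count_poly v" by (auto simp: bad_def)
  qed
qed

text \<open>Two distinct pairs collide for at most one \<beta>, so finitely many values of \<beta>
  are excluded.\<close>

lemma exists_inj_on_linear_combination:
  fixes E :: "(real \<times> real) set"
  assumes "finite E"
  shows "\<exists>\<beta>. inj_on (\<lambda>(z, g). z + \<beta> * g) E"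
proof -
  \<comment> \<open>Pairs with equal second components contribute only 0, because division by zero
    gives 0; excluding that value is harmless.\<close>
  define bad where "bad = (\<lambda>(p, q). (fst q - fst p) / (snd p - snd q)) ` (E \<times> E)"
  have "finite bad" using assms by (simp add: bad_def)
  then obtain \<beta> where \<beta>: "\<beta> \<notin> bad"
    using ex_new_if_finite infinite_UNIV_char_0 by blast
  have "p = q" if "p \<in> E" "q \<in> E" "fst p + \<beta> * snd p = fst q + \<beta> * snd q" for p q
  proof (cases "snd p = snd q")
    case True
    with that show ?thesis by (simp add: prod_eq_iff)
  next
    case False
    with that(3) have "\<beta> = (fst q - fst p) / (snd p - snd q)" by (simp add: field_simps)
    then have "\<beta> \<in> bad"
      unfolding bad_def using that by (intro image_eqI[of _ _ "(p, q)"]) simp_all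
    with \<beta> show ?thesis by simp
  qed
  then show ?thesis by (intro exI[of _ \<beta>]) (auto simp: inj_on_def case_prod_beta)
qed

text \<open>\<alpha> lets the mean reveal the multiset of all tokens, and \<beta> lets the sum
  reveal both the token and the mean. Positivity of the tokens keeps the inverse temperatures from
  being forced to 0.\<close>

lemma exists_attention_parameters:
  fixes U :: "('n::finite \<Rightarrow> nat) set"
  assumes "finite U" "\<And>u k. u \<in> U \<Longrightarrow> u k > 0"
  shows "\<exists>\<alpha> \<beta>. \<forall>u\<in>U. \<forall>v\<in>U. \<forall>k l.
    real (u k) + \<beta> * softmax_mean (\<lambda>j. real (u j)) (\<alpha> * real (u k))
      = real (v l) + \<beta> * softmax_mean (\<lambda>j. real (v j)) (\<alpha> * real (v l))
    \<longrightarrow> (\<exists>\<pi>. \<pi> permutes UNIV \<and> v = u \<circ> \<pi> \<and> \<pi> l = k)"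
proof -
  define N where "N = (\<Union>u\<in>U. range u)"
  have N: "finite N" "0 \<notin> N"
    using assms(1) assms(2)[THEN less_imp_neq] by (simp_all add: N_def image_iff)
  obtain \<alpha> where \<alpha>: "\<forall>u\<in>U. \<forall>v\<in>U. \<forall>m\<in>N.
    softmax_mean (\<lambda>k. real (u k)) (\<alpha> * real m) = softmax_mean (\<lambda>k. real (v k)) (\<alpha> * real m)
    \<longrightarrow> count_poly u = count_poly v"
    using exists_separating_temperature[OF assms(1) N] ..
  define E where "E = (\<lambda>(u, k). (real (u k), softmax_mean (\<lambda>j. real (u j)) (\<alpha> * real (u k)))) ` (U \<times> UNIV)"
  have "finite E" using assms by (simp add: E_def)
  then obtain \<beta> where \<beta>: "inj_on (\<lambda>(z, g). z + \<beta> * g) E"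
    using exists_inj_on_linear_combination by blast
  show ?thesis
  proof (rule exI[of _ \<alpha>], rule exI[of _ \<beta>], intro ballI allI impI)
    fix u v :: "'n \<Rightarrow> nat" and k l assume uv: "u \<in> U" "v \<in> U"
      and eq: "real (u k) + \<beta> * softmax_mean (\<lambda>j. real (u j)) (\<alpha> * real (u k))
      = real (v l) + \<beta> * softmax_mean (\<lambda>j. real (v j)) (\<alpha> * real (v l))"
    have mem: "(real (w j), softmax_mean (\<lambda>j. real (w j)) (\<alpha> * real (w j))) \<in> E" if "w \<in> U" for w j
      unfolding E_def using that by (intro image_eqI[of _ _ "(w, j)"]) simp_all
    have "(real (u k), softmax_mean (\<lambda>j. real (u j)) (\<alpha> * real (u k)))
        = (real (v l), softmax_mean (\<lambda>j. real (v j)) (\<alpha> * real (v l)))"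
      by (rule inj_onD[OF \<beta> _ mem[OF uv(1)] mem[OF uv(2)]]) (simp add: eq)
    then have ukvl: "u k = v l"
      and "softmax_mean (\<lambda>j. real (u j)) (\<alpha> * real (u k)) = softmax_mean (\<lambda>j. real (v j)) (\<alpha> * real (v l))"
      unfolding prod.inject of_nat_eq_iff by (rule conjunct1, rule conjunct2)
    then have "softmax_mean (\<lambda>j. real (v j)) (\<alpha> * real (u k)) = softmax_mean (\<lambda>j. real (u j)) (\<alpha> * real (u k))"
      by (simp only: ukvl)
    moreover have "u k \<in> N" unfolding N_def using uv(1) by blast
    ultimately have "count_poly v = count_poly u"
      using \<alpha> uv by blast
    then obtain \<pi> where \<pi>: "\<pi> permutes UNIV" "v = u \<circ> \<pi>"
      by (rule count_poly_eq_imp_permutes)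
    have "u (\<pi> l) = u k" using \<pi>(2) ukvl by simp
    \<comment> \<open>\<pi> may send \<open>l\<close> to a position other than \<open>k\<close> that
      carries the same value; swapping these two positions leaves \<open>u\<close> unchanged and
      repairs this.\<close>
    then have "v = u \<circ> (Transposition.transpose (\<pi> l) k \<circ> \<pi>)"
      unfolding \<pi>(2) fun_eq_iff by (simp add: Transposition.transpose_def)
    moreover have "(Transposition.transpose (\<pi> l) k \<circ> \<pi>) permutes UNIV"
      by (intro permutes_compose[OF \<pi>(1)] permutes_swap_id UNIV_I)
    moreover have "(Transposition.transpose (\<pi> l) k \<circ> \<pi>) l = k" by simp
    ultimately show "\<exists>\<pi>. \<pi> permutes UNIV \<and> v = u \<circ> \<pi> \<and> \<pi> l = k" by blast
  qed
qed

section \<open>Convergence in \<open>L\<^sup>p\<close>\<close>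

text \<open>The limit \<open>G\<close> may be discontinuous; dominated convergence, with the uniform
  bound \<open>B\<close>, transfers its error bound to late members of the sequence.\<close>

lemma lp_dist_small_of_pointwise:
  fixes f G :: "real^'n^'d \<Rightarrow> real^'n^'d" and g :: "nat \<Rightarrow> real^'n^'d \<Rightarrow> real^'n^'d"
  assumes K: "compact K" and f: "continuous_on K f" and p: "p \<ge> 1" and \<epsilon>: "\<epsilon> > 0"
    and g: "\<And>m. continuous_on K (g m)"
    and B: "\<And>m X i k. X \<in> K \<Longrightarrow> \<bar>g m X $ i $ k\<bar> \<le> B"
    and lim: "\<And>X. X \<in> K \<Longrightarrow> \<forall>\<^sub>F m in sequentially. g m X = G X"
    and close: "\<And>X i k. X \<in> K \<Longrightarrow> \<bar>f X $ i $ k - G X $ i $ k\<bar> powr p \<le> \<delta>"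
    and \<delta>: "real CARD('n) * real CARD('d) * \<delta> * measure lborel K < \<epsilon> powr p"
  shows "\<exists>m. lp_dist p K f (g m) < \<epsilon>"
proof -
  define \<Phi> where "\<Phi> A = (\<Sum>i\<in>UNIV. \<Sum>k\<in>UNIV. \<bar>A $ i $ k\<bar> powr p)" for A :: "real^'n^'d"
  have \<Phi>: "entrywise_norm p A powr p = \<Phi> A" for A
    using p by (simp add: entrywise_norm_def \<Phi>_def powr_powr sum_nonneg)
  obtain Bf where Bf: "\<And>X. X \<in> K \<Longrightarrow> norm (f X) \<le> Bf"
    using compact_imp_bounded[OF compact_continuous_image[OF f K]] by (auto simp: bounded_iff)
  define h where "h m X = indicator K X *\<^sub>R \<Phi> (f X - g m X)" for m X
  define H where "H X = indicator K X *\<^sub>R \<Phi> (f X - G X)" for X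
  \<comment> \<open>Dominates \<open>h m\<close> on \<open>K\<close>: every entry of
    \<open>f X - g m X\<close> is at most \<open>Bf + B\<close> in absolute value.\<close>
  define D where "D = real CARD('n) * real CARD('d) * (Bf + B) powr p"
  have int: "integrable lborel (h m)" for m
    using set_integrable_entrywise_norm_powr[OF K f g p] unfolding set_integrable_def \<Phi> h_def[abs_def] .
  have K_int: "integrable lborel (\<lambda>X. indicator K X *\<^sub>R c)" for c :: real
    using borel_integrable_compact[OF K continuous_on_const] .
  have conv: "(\<lambda>m. h m X) \<longlonglongrightarrow> H X" for X
  proof (cases "X \<in> K")
    case True
    then show ?thesis
      using lim[OF True] by (intro tendsto_eventually) (auto simp: h_def H_def elim: eventually_mono)
  qed (simp add: h_def H_def)
  have H_meas: "H \<in> borel_measurable lborel"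
    using borel_measurable_LIMSEQ_real[of lborel h H] conv int by blast
  have bound: "norm (h m X) \<le> indicator K X *\<^sub>R D" for m X
  proof (cases "X \<in> K")
    case True
    have "\<bar>f X $ i $ k - g m X $ i $ k\<bar> \<le> Bf + B" for i k
      using B[OF True, of m i k] Bf[OF True] component_le_norm_cart[of "f X $ i" k]
        Finite_Cartesian_Product.norm_nth_le[of "f X" i]
      by linarith
    then have "\<Phi> (f X - g m X) \<le> (\<Sum>i\<in>(UNIV :: 'd set). \<Sum>k\<in>(UNIV :: 'n set). (Bf + B) powr p)"
      unfolding \<Phi>_def using p by (intro sum_mono powr_mono2) auto
    moreover have "\<Phi> (f X - g m X) \<ge> 0" by (simp add: \<Phi>_def sum_nonneg)
    ultimately show ?thesis using True by (simp add: h_def D_def ac_simps)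
  qed (simp add: h_def)
  have "(\<lambda>m. integral\<^sup>L lborel (h m)) \<longlonglongrightarrow> integral\<^sup>L lborel H"
    using integral_dominated_convergence[OF H_meas _ K_int[of D], of h] int conv bound by auto
  moreover have "integral\<^sup>L lborel H < \<epsilon> powr p"
  proof -
    have "H X \<le> indicator K X *\<^sub>R (real CARD('n) * real CARD('d) * \<delta>)" for X
    proof (cases "X \<in> K")
      case True
      have "\<Phi> (f X - G X) \<le> (\<Sum>i\<in>(UNIV :: 'd set). \<Sum>k\<in>(UNIV :: 'n set). \<delta>)"
        unfolding \<Phi>_def using close[OF True] by (intro sum_mono) auto
      then show ?thesis using True by (simp add: H_def ac_simps)
    qed (simp add: H_def)
    moreover have "integrable lborel H"
      using integrable_dominated_convergence[OF H_meas _ K_int[of D], of h] int conv bound by auto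
    ultimately have "integral\<^sup>L lborel H
        \<le> integral\<^sup>L lborel (\<lambda>X. indicator K X *\<^sub>R (real CARD('n) * real CARD('d) * \<delta>))"
      by (intro integral_mono K_int)
    also have "\<dots> = measure lborel K * (real CARD('n) * real CARD('d) * \<delta>)"
      using fmeasurable_compact[OF K] by (simp add: fmeasurable_def)
    finally show ?thesis using \<delta> by (simp add: ac_simps)
  qed
  ultimately obtain m where m: "integral\<^sup>L lborel (h m) < \<epsilon> powr p"
    using order_tendstoD(2) eventually_happens'[OF sequentially_bot] by blast
  have "0 \<le> integral\<^sup>L lborel (h m)"
    by (intro integral_nonneg_AE) (auto simp: h_def \<Phi>_def sum_nonneg)
  then have "integral\<^sup>L lborel (h m) powr (1 / p) < (\<epsilon> powr p) powr (1 / p)"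
    using m p by (intro powr_less_mono2) auto
  then have "integral\<^sup>L lborel (h m) powr (1 / p) < \<epsilon>"
    using p \<epsilon> by (simp add: powr_powr)
  then show ?thesis
    unfolding lp_dist_def \<Phi> set_lebesgue_integral_def h_def[abs_def] by blast
qed

section \<open>Quantization\<close>

text \<open>Every row is tested against the points of a grid covering the range of all entries.
  Entries further apart than the mesh are separated by a grid point, so agreement of all tests
  bounds each entrywise difference. The tests refer to rows only, hence can be run on each token
  separately.\<close>

lemma exists_threshold_tests:
  fixes K :: "(real^'n^'d) set"
  assumes "bounded K" "\<delta> > 0"
  shows "\<exists>N row t. \<forall>X\<in>K. \<forall>Y\<in>K. (\<forall>k. \<forall>a<(N::nat). X $ row a $ k > t a \<longleftrightarrow> Y $ row a $ k > t a)
    \<longrightarrow> dist X Y < (\<delta> :: real)"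
proof -
  obtain R where R: "\<And>X. X \<in> K \<Longrightarrow> norm X \<le> R" using assms by (auto simp: bounded_iff)
  \<comment> \<open>The factor 2 keeps the sum of all entrywise differences at most half of
    \<delta>, hence strictly below \<delta>.\<close>
  define \<eta> where "\<eta> = \<delta> / (2 * real CARD('d) * real CARD('n))"
  have \<eta>: "\<eta> > 0" using assms by (simp add: \<eta>_def)
  define M where "M = Suc (nat \<lceil>2 * R / \<eta>\<rceil>)"
  define I where "I = (UNIV :: 'd set) \<times> {..<M}"
  have "finite I" by (simp add: I_def)
  \<comment> \<open>Numbers the pairs of row and grid level, so that the tests can later serve as
    binary digits.\<close>
  then obtain e where e: "bij_betw e {0..<card I} I" using ex_bij_betw_nat_finite by blast
  define t where "t a = - R + real (snd (e a)) * \<eta>" for a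
  define row where "row a = fst (e a)" for a
  have entry: "\<bar>X $ i $ k\<bar> \<le> R" if "X \<in> K" for X i k
    using R[OF that] component_le_norm_cart[of "X $ i" k] Finite_Cartesian_Product.norm_nth_le[of X i]
    by linarith
  have sep: "\<exists>a<card I. row a = i \<and> x \<le> t a \<and> t a < y"
    if "\<bar>x\<bar> \<le> R" "\<bar>y\<bar> \<le> R" "y - x > \<eta>" for x y i
  proof -
    \<comment> \<open>The first grid point at or above \<open>x\<close>; it exceeds \<open>x\<close>
      by less than the mesh, hence lies below \<open>y\<close>.\<close>
    define j where "j = nat \<lceil>(x + R) / \<eta>\<rceil>"
    have "real j = of_int \<lceil>(x + R) / \<eta>\<rceil>"
    proof -
      have "0 \<le> (x + R) / \<eta>" using that \<eta> by simp
      then show ?thesis unfolding j_def by (intro of_nat_nat) linarith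
    qed
    then have "(x + R) / \<eta> \<le> real j" "real j < (x + R) / \<eta> + 1" by linarith+
    then have j: "x + R \<le> real j * \<eta>" "real j * \<eta> < x + R + \<eta>"
      using \<eta> by (simp_all add: field_simps)
    have "real j * \<eta> < 2 * R" using j(2) that by linarith
    then have "real j < 2 * R / \<eta>" using \<eta> by (simp add: field_simps)
    then have "j < M" unfolding M_def by linarith
    then have "(i, j) \<in> e ` {0..<card I}" using bij_betw_imp_surj_on[OF e] by (simp add: I_def)
    then obtain a where "a < card I" "e a = (i, j)" by auto
    then show ?thesis using j that by (intro exI[of _ a]) (auto simp: row_def t_def)
  qed
  have "dist X Y < \<delta>"
    if XY: "X \<in> K" "Y \<in> K"
      and agree: "\<And>k a. a < card I \<Longrightarrow> X $ row a $ k > t a \<longleftrightarrow> Y $ row a $ k > t a" for X Y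
  proof -
    have "\<bar>X $ i $ k - Y $ i $ k\<bar> \<le> \<eta>" for i k
    proof (rule ccontr)
      assume "\<not> ?thesis"
      then consider "Y $ i $ k - X $ i $ k > \<eta>" | "X $ i $ k - Y $ i $ k > \<eta>" by linarith
      then show False
        using sep[of "X $ i $ k" "Y $ i $ k" i] sep[of "Y $ i $ k" "X $ i $ k" i] entry XY agree
        by (smt (verit))
    qed
    then have "(\<Sum>i\<in>UNIV. \<Sum>k\<in>UNIV. \<bar>(X - Y) $ i $ k\<bar>) \<le> (\<Sum>i\<in>(UNIV :: 'd set). \<Sum>k\<in>(UNIV :: 'n set). \<eta>)"
      by (intro sum_mono) simp
    also have "\<dots> = \<delta> / 2" by (simp add: \<eta>_def)
    finally have "(\<Sum>i\<in>UNIV. \<Sum>k\<in>UNIV. \<bar>(X - Y) $ i $ k\<bar>) \<le> \<delta> / 2" .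
    moreover have "norm (X - Y) \<le> (\<Sum>i\<in>UNIV. norm ((X - Y) $ i))"
      by (simp add: norm_vec_def L2_set_le_sum)
    moreover have "(\<Sum>i\<in>UNIV. norm ((X - Y) $ i)) \<le> (\<Sum>i\<in>UNIV. \<Sum>k\<in>UNIV. \<bar>(X - Y) $ i $ k\<bar>)"
      by (intro sum_mono norm_le_l1_cart)
    ultimately show ?thesis using assms by (simp add: dist_norm)
  qed
  then show ?thesis by blast
qed

text \<open>For \<open>m > 0\<close> the ramp climbs from 0 to 1 over the interval from 0 to
  \<open>1 / m\<close>. It lies to the right of the threshold, so the value at 0 is 0 as the strict
  test demands, and every positive point eventually lies beyond it.\<close>

lemma relu_ramp_eventually:
  "\<forall>\<^sub>F m in sequentially. relu (real m * x) - relu (real m * x - 1) = of_bool (x > 0)"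
proof (cases "x > 0")
  case True
  have "\<forall>\<^sub>F m in sequentially. 1 / x \<le> real m"
    using filterlim_real_sequentially by (simp add: filterlim_at_top)
  then show ?thesis
  proof eventually_elim
    case (elim m)
    then have "1 \<le> real m * x" using True by (simp add: pos_divide_le_eq)
    then show ?case using True by (simp add: relu_def)
  qed
next
  case False
  then have "real m * x \<le> 0" for m by (simp add: mult_nonneg_nonpos)
  then have "relu (real m * x) - relu (real m * x - 1) = of_bool (x > 0)" for m
    unfolding relu_def using False by (smt (verit) of_bool_eq(1))
  then show ?thesis by simp
qed

lemma relu_ramp_bounds: "0 \<le> relu x - relu (x - 1)" "relu x - relu (x - 1) \<le> 1"
  by (auto simp: relu_def)

section \<open>Universal approximation\<close>

theorem proposition1:
  fixes K :: "(real^'n^'d) set"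
    and f :: "real^'n^'d \<Rightarrow> real^'n^'d"
    and p \<epsilon> :: real
  assumes "p \<ge> 1"
    and "compact K"
    and "column_permutation_invariant K"
    and "continuous_on K f"
    and "permutation_equivariant_on K f"
    and "\<epsilon> > 0"
  shows "\<exists>g \<in> transformers2. lp_dist p K f g < \<epsilon>"
proof -
  define i0 :: 'd where "i0 = undefined"

  \<comment> \<open>Error tolerances\<close>
  define V where "V = real CARD('n) * real CARD('d) * measure lborel K"
  have "V \<ge> 0" unfolding V_def by (intro mult_nonneg_nonneg measure_nonneg of_nat_0_le_iff)
  \<comment> \<open>The error allowed in the \<open>p\<close>-th power of each entry. The
    \<open>+ 1\<close> covers a null set \<open>K\<close> and makes the total strictly smaller than
    \<open>\<epsilon> powr p\<close>.\<close>
  define \<kappa> where "\<kappa> = \<epsilon> powr p / (V + 1)"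
  have "\<epsilon> powr p > 0" using assms(6) by simp
  then have "\<kappa> > 0" using \<open>V \<ge> 0\<close> unfolding \<kappa>_def by (intro divide_pos_pos) linarith+
  have "\<kappa> * (V + 1) = \<epsilon> powr p" using \<open>V \<ge> 0\<close> unfolding \<kappa>_def by simp
  then have "\<kappa> * V < \<epsilon> powr p" using \<open>\<kappa> > 0\<close> by (simp only: distrib_left)
  moreover have "real CARD('n) * real CARD('d) * \<kappa> * measure lborel K = \<kappa> * V"
    unfolding V_def by (simp only: mult.commute mult.left_commute mult.assoc)
  ultimately have \<kappa>: "real CARD('n) * real CARD('d) * \<kappa> * measure lborel K < \<epsilon> powr p"
    by (simp only:)
  define \<delta> where "\<delta> = \<kappa> powr (1 / p)"
  have "\<delta> > 0" using \<open>\<kappa> > 0\<close> by (simp add: \<delta>_def)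
  have \<delta>_powr: "\<bar>x\<bar> powr p \<le> \<kappa>" if "\<bar>x\<bar> \<le> \<delta>" for x
  proof -
    have "\<bar>x\<bar> powr p \<le> \<delta> powr p" using that assms(1) by (intro powr_mono2) auto
    then show ?thesis using \<open>\<kappa> > 0\<close> assms(1) by (simp add: \<delta>_def powr_powr)
  qed

  \<comment> \<open>Integer codes and context values\<close>
  obtain \<delta>' where "\<delta>' > 0"
    and \<delta>': "\<And>X Y. X \<in> K \<Longrightarrow> Y \<in> K \<Longrightarrow> dist Y X < \<delta>' \<Longrightarrow> dist (f Y) (f X) < \<delta>"
    by (rule uniformly_continuous_onE[OF compact_uniformly_continuous[OF assms(4,2)] \<open>\<delta> > 0\<close>]) blast
  obtain N :: nat and row t where tests: "\<forall>X\<in>K. \<forall>Y\<in>K.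
      (\<forall>k. \<forall>a<N. X $ row a $ k > t a \<longleftrightarrow> Y $ row a $ k > t a) \<longrightarrow> dist X Y < \<delta>'"
    using exists_threshold_tests[OF compact_imp_bounded[OF assms(2)] \<open>\<delta>' > 0\<close>] by (elim exE)

  \<comment> \<open>The test outcomes of a column are the binary digits of its code;
    \<open>Suc\<close> makes the code positive, as \<open>exists_attention_parameters\<close>
    requires.\<close>
  define u where "u X = (\<lambda>k. Suc (set_encode {a. a < N \<and> X $ row a $ k > t a}))" for X :: "real^'n^'d"
  have u_dist: "dist X Y < \<delta>'" if "X \<in> K" "Y \<in> K" "u X = u Y" for X Y
  proof (rule tests[rule_format, OF that(1,2)])
    fix k a assume "a < N"
    have "{a. a < N \<and> X $ row a $ k > t a} = {a. a < N \<and> Y $ row a $ k > t a}"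
      using fun_cong[OF that(3), of k] by (simp add: u_def set_encode_eq)
    with \<open>a < N\<close> show "X $ row a $ k > t a \<longleftrightarrow> Y $ row a $ k > t a" by blast
  qed
  \<comment> \<open>The code with all digits set.\<close>
  define L where "L = Suc (set_encode {..<N})"
  have u_le: "u X k \<le> L" for X k
    unfolding u_def L_def set_encode_def by (auto intro!: sum_mono2)
  have u_pos: "v k > 0" if "v \<in> range u" for v k
    using that by (auto simp: u_def)
  have "finite (range u)"
  proof (rule finite_subset)
    show "range u \<subseteq> UNIV \<rightarrow>\<^sub>E {..L}" using u_le by auto
  qed (simp add: finite_PiE)
  then obtain \<alpha> \<beta> where ctx: "\<forall>v\<in>range u. \<forall>w\<in>range u. \<forall>k l.
    real (v k) + \<beta> * softmax_mean (\<lambda>j. real (v j)) (\<alpha> * real (v k))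
      = real (w l) + \<beta> * softmax_mean (\<lambda>j. real (w j)) (\<alpha> * real (w l))
    \<longrightarrow> (\<exists>\<pi>. \<pi> permutes UNIV \<and> w = v \<circ> \<pi> \<and> \<pi> l = k)"
    using exists_attention_parameters[of "range u"] u_pos by blast
  define c where "c y k = y k + \<beta> * softmax_mean y (\<alpha> * y k)" for y :: "'n \<Rightarrow> real" and k
  define C where "C = (\<lambda>(v, k). c (\<lambda>j. real (v j)) k) ` (range u \<times> UNIV)"
  have "finite C" using \<open>finite (range u)\<close> by (simp add: C_def)

  \<comment> \<open>\<open>S x\<close> is arbitrary unless \<open>x\<close> is the context value of a column of some input in \<open>K\<close>.\<close>
  define S where "S x = (SOME (X, k). X \<in> K \<and> c (\<lambda>j. real (u X j)) k = x)" for x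
  define T where "T x = column (snd (S x)) (f (fst (S x)))" for x
  have T: "\<bar>f Y $ i $ l - T (c (\<lambda>j. real (u Y j)) l) $ i\<bar> \<le> \<delta>" if "Y \<in> K" for Y i l
  proof -
    let ?x = "c (\<lambda>j. real (u Y j)) l"
    have "case S ?x of (X, k) \<Rightarrow> X \<in> K \<and> c (\<lambda>j. real (u X j)) k = ?x"
      unfolding S_def by (rule someI[of _ "(Y, l)"]) (use that in simp)
    then obtain X k where Xk: "S ?x = (X, k)" "X \<in> K" "c (\<lambda>j. real (u X j)) k = ?x"
      by (auto split: prod.splits)
    then obtain \<pi> where \<pi>: "\<pi> permutes UNIV" "u Y = u X \<circ> \<pi>" "\<pi> l = k"
      using ctx[rule_format, OF rangeI rangeI] unfolding c_def by blast
    \<comment> \<open>Rearranging the representative \<open>X\<close> by \<open>P\<close> gives it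
      the same code as \<open>Y\<close> and moves column \<open>k\<close> to position
      \<open>l\<close>, so equivariance turns column \<open>k\<close> of \<open>f X\<close> into
      column \<open>l\<close> of \<open>f (X ** P)\<close>.\<close>
    define P :: "real^'n^'n" where "P = (\<chi> i j. if i = \<pi> j then 1 else 0)"
    have "permutation_matrix P" unfolding permutation_matrix_def P_def using \<pi>(1) by blast
    have mult_P: "(Z ** P) $ i $ j = Z $ i $ \<pi> j" for Z :: "real^'n^'d" and i j
      by (simp add: matrix_matrix_mult_def P_def if_distrib cong: if_cong)
    have "X ** P \<in> K" "f (X ** P) = f X ** P"
      using assms(3,5) Xk(2) \<open>permutation_matrix P\<close>
      by (auto simp: column_permutation_invariant_def permutation_equivariant_on_def)
    moreover have "u Y = u (X ** P)"
      unfolding \<pi>(2) by (simp add: u_def fun_eq_iff mult_P)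
    ultimately have "dist (f Y) (f X ** P) < \<delta>"
      using \<delta>'[of "X ** P" Y] u_dist[of Y "X ** P"] that by simp
    then have "\<bar>(f Y - f X ** P) $ i $ l\<bar> \<le> \<delta>"
      using component_le_norm_cart[of "(f Y - f X ** P) $ i" l]
        Finite_Cartesian_Product.norm_nth_le[of "f Y - f X ** P" i]
      unfolding dist_norm by linarith
    then show ?thesis using Xk(1) \<pi>(3) by (simp add: T_def mult_P column_def)
  qed

  \<comment> \<open>The three layers\<close>
  obtain F where F: "(\<lambda>h. F (h $ i0)) \<in> relu_nets" "\<And>x. x \<in> C \<Longrightarrow> F x = T x"
    using relu_nets_interpolate[OF \<open>finite C\<close>] by blast
  define ramp where "ramp m x = relu (real m * x) - relu (real m * x - 1)" for m x
  \<comment> \<open>A continuous version of the code \<open>u\<close>: the summand 1 stands for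
    \<open>Suc\<close>, and the powers of 2 are the digit weights of
    \<open>set_encode\<close>.\<close>
  define y where "y m X k = 1 + (\<Sum>a<N. 2 ^ a * ramp m (X $ row a $ k - t a))"
    for m and X :: "real^'n^'d" and k
  define F1 where "F1 m X = (\<chi> i k. if i = i0 then y m X k else 0)" for m X
  define F2 where "F2 H = (\<chi> i k. F (column k H $ i0) $ i)" for H :: "real^'n^'d"
  define A :: "real^'n^'d \<Rightarrow> real^'n^'d" where
    "A = self_attention 1 (\<lambda>_. axis i0 \<beta>) (\<lambda>_. axis i0 1) (\<lambda>_. axis i0 \<alpha>) (\<lambda>_. axis i0 1)"
  \<comment> \<open>The output under exact quantization.\<close>
  define G where "G X = (\<chi> i k. T (c (\<lambda>j. real (u X j)) k) $ i)" for X

  have F2: "F2 \<in> feed_forward_layers"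
    unfolding F2_def[abs_def] by (rule feed_forward_layers_relu_nets[OF F(1)])
  have A: "A \<in> self_attention_layers"
    unfolding A_def self_attention_layers_def by blast
  have F1: "F1 m \<in> feed_forward_layers" for m
  proof -
    \<comment> \<open>Each ramp takes two neurons whose biases differ by 1 and whose output weights
      are opposite.\<close>
    define net :: "real^'d \<Rightarrow> real^'d" where "net = (\<lambda>h. axis i0 1 +
      (\<Sum>a<N. relu (axis (row a) (real m) \<bullet> h + (- real m * t a)) *\<^sub>R axis i0 (2 ^ a)
        + relu (axis (row a) (real m) \<bullet> h + (- real m * t a - 1)) *\<^sub>R axis i0 (- (2 ^ a))))"
    have "net \<in> relu_nets"
      unfolding net_def
      by (intro relu_nets_add relu_nets_sum relu_nets_neuron relu_nets.const)
    have "net (column k X) $ i = (if i = i0 then y m X k else 0)" for X :: "real^'n^'d" and i k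
    proof -
      have "axis (row a) (real m) \<bullet> column k X + (- real m * t a) = real m * (X $ row a $ k - t a)" for a
        by (simp add: inner_axis' column_def right_diff_distrib)
      then have "relu (axis (row a) (real m) \<bullet> column k X + (- real m * t a)) *\<^sub>R axis i0 (2 ^ a)
          + relu (axis (row a) (real m) \<bullet> column k X + (- real m * t a - 1)) *\<^sub>R axis i0 (- (2 ^ a))
          = axis i0 (2 ^ a * ramp m (X $ row a $ k - t a))" for a
        by (simp add: ramp_def vec_eq_iff axis_def algebra_simps)
      then show ?thesis
        by (simp add: net_def y_def axis_def sum_component)
    qed
    then have F1_net: "F1 m = (\<lambda>X. \<chi> i k. net (column k X) $ i)"
      by (simp add: F1_def fun_eq_iff vec_eq_iff)
    show ?thesis unfolding F1_net by (rule feed_forward_layers_relu_nets) fact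
  qed
  have g: "F2 \<circ> A \<circ> F1 m \<in> transformers2" for m
    unfolding transformers2_def using F2 A F1 by blast

  \<comment> \<open>Bounds uniform in the steepness\<close>
  have "continuous_on S F2" for S
    using F2 unfolding feed_forward_layers_def by (auto intro: continuous_on_feed_forward)
  then have "continuous_on UNIV (F2 \<circ> A)"
    unfolding A_def by (intro continuous_on_compose continuous_on_self_attention)
  \<comment> \<open>The entries after the first layer lie between 0 and \<open>L\<close> for every
    steepness, so all its outputs stay in this ball, on which the fixed continuous map
    \<open>F2 \<circ> A\<close> is bounded.\<close>
  moreover define r where "r = (\<Sum>i\<in>(UNIV :: 'd set). \<Sum>k\<in>(UNIV :: 'n set). real L)"
  ultimately have "bounded ((F2 \<circ> A) ` cball 0 r)"
    by (intro compact_imp_bounded compact_continuous_image compact_cball)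
      (auto intro: continuous_on_subset)
  then obtain B where F2_A: "norm (F2 (A H)) \<le> B" if "norm H \<le> r" for H
    unfolding bounded_iff by (metis comp_apply image_eqI mem_cball_0)
  have "norm (F1 m X) \<le> r" for m X
  proof -
    have "(\<Sum>a<N. 2 ^ a * ramp m (X $ row a $ k - t a)) \<le> (\<Sum>a<N. 2 ^ a * 1)" for k
      using relu_ramp_bounds(2) by (intro sum_mono mult_left_mono) (auto simp: ramp_def)
    moreover have "0 \<le> (\<Sum>a<N. 2 ^ a * ramp m (X $ row a $ k - t a))" for k
      using relu_ramp_bounds(1) by (intro sum_nonneg mult_nonneg_nonneg) (auto simp: ramp_def)
    ultimately have y_bounds: "0 \<le> y m X k" "y m X k \<le> L" for k
      unfolding y_def L_def set_encode_def by (simp_all add: add_nonneg_nonneg)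
    have "norm (F1 m X) \<le> (\<Sum>i\<in>UNIV. norm (F1 m X $ i))"
      by (simp add: norm_vec_def L2_set_le_sum)
    also have "\<dots> \<le> (\<Sum>i\<in>UNIV. \<Sum>k\<in>UNIV. \<bar>F1 m X $ i $ k\<bar>)"
      by (intro sum_mono norm_le_l1_cart)
    also have "\<dots> \<le> (\<Sum>i\<in>(UNIV :: 'd set). \<Sum>k\<in>(UNIV :: 'n set). real L)"
      using y_bounds by (intro sum_mono) (auto simp: F1_def)
    finally show ?thesis by (simp only: r_def)
  qed
  then have "norm ((F2 \<circ> A \<circ> F1 m) X) \<le> B" for m X
    using F2_A by simp
  then have B: "\<bar>(F2 \<circ> A \<circ> F1 m) X $ i $ k\<bar> \<le> B" for m X i k
    using component_le_norm_cart[of "(F2 \<circ> A \<circ> F1 m) X $ i" k]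
      Finite_Cartesian_Product.norm_nth_le[of "(F2 \<circ> A \<circ> F1 m) X" i]
    by (meson order_trans)

  \<comment> \<open>Pointwise limit\<close>
  have lim: "\<forall>\<^sub>F m in sequentially. (F2 \<circ> A \<circ> F1 m) X = G X" for X
  proof -
    \<comment> \<open>There are finitely many tests and columns, so from some steepness on all ramps
      have their exact values at once.\<close>
    have "\<forall>\<^sub>F m in sequentially. \<forall>a\<in>{..<N}. \<forall>k\<in>UNIV.
        ramp m (X $ row a $ k - t a) = of_bool (X $ row a $ k - t a > 0)"
      unfolding ramp_def
      by (intro eventually_ball_finite ballI relu_ramp_eventually) auto
    then show ?thesis
    proof eventually_elim
      case (elim m)
      have "y m X = (\<lambda>k. real (u X k))"
      proof
        fix k
        have "(\<Sum>a<N. 2 ^ a * ramp m (X $ row a $ k - t a))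
            = (\<Sum>a<N. if X $ row a $ k > t a then 2 ^ a else 0 :: real)"
          using elim by (intro sum.cong) auto
        also have "\<dots> = (\<Sum>a\<in>{a. a < N \<and> X $ row a $ k > t a}. 2 ^ a)"
          by (simp add: sum.If_cases) (rule sum.cong; auto)
        finally show "y m X k = real (u X k)" by (simp add: y_def u_def set_encode_def)
      qed
      then have "A (F1 m X) = (\<chi> i k. if i = i0 then c (\<lambda>j. real (u X j)) k else 0)"
        unfolding A_def F1_def self_attention_on_axis c_def by (simp add: vec_eq_iff)
      moreover have "F (c (\<lambda>j. real (u X j)) k) = T (c (\<lambda>j. real (u X j)) k)" for k
        by (rule F(2)) (auto simp: C_def)
      ultimately show ?case
        by (simp add: F2_def G_def column_def)
    qed
  qed

  have "\<exists>m. lp_dist p K f (F2 \<circ> A \<circ> F1 m) < \<epsilon>"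
  proof (rule lp_dist_small_of_pointwise[OF assms(2,4,1,6) continuous_on_transformers2[OF g] B lim])
    show "\<bar>f X $ i $ k - G X $ i $ k\<bar> powr p \<le> \<kappa>" if "X \<in> K" for X i k
      using T[OF that, of i k] by (intro \<delta>_powr) (simp add: G_def)
  qed (rule \<kappa>)
  with g show ?thesis by blast
qed

end
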